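(* For $n\in\mathbb{N}$ and $p=p(n)\in[0,1]$, let $[n]_p$ denote the random subset of $[n]=\{1,\dots,n\}$ obtained by including each integer independently with probability $p$. Then: (0) there is a function $\varepsilon(n)\to 0$ such that if $p\le n^{-1/9-\varepsilon(n)}$, then $\lim_{n\to\infty}\Pr([n]_p \text{ is product-Schur})=0$; (1) if $p=\omega(n^{-1/11})$ (i.e. $p\,n^{1/11}\to\infty$), then $\lim_{n\to\infty}\Pr([n]_p \text{ is product-Schur})=1$.
   Context: A set $A\subseteq\mathbb{N}$ is product-Schur if every 2-colouring of $A$ yields $a,b,c\in A$ of the same colour with $ab=c$ (the degenerate case $a=b$ is allowed). *)

theory Defs
  imports "HOL-Probability.Probability" "HOL-Probability.Product_PMF"
begin

text \<open>A 2-colouring of \<open>A\<close> is given by a function on all of \<open>nat\<close>; only its values on \<open>A\<close>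
  matter. The elements \<open>a\<close> and \<open>b\<close> need not be distinct. The notion is meant for sets of
  positive integers: a set containing \<open>0\<close> would satisfy it for the trivial reason \<open>0 * 0 = 0\<close>.\<close>

definition product_Schur :: "nat set \<Rightarrow> bool" where
  "product_Schur A \<longleftrightarrow>
     (\<forall>f :: nat \<Rightarrow> bool. \<exists>a\<in>A. \<exists>b\<in>A. \<exists>c\<in>A. f a = f b \<and> f b = f c \<and> a * b = c)"

text \<open>The law of \<open>[n]\<^sub>p\<close>. Independent Bernoulli variables decide the membership of the elements
  of \<open>{1..n}\<close>; \<open>False\<close> is only the default value of the product outside that set.\<close>

definition random_subset :: "nat \<Rightarrow> real \<Rightarrow> nat set pmf" where
  "random_subset n p =
     map_pmf (\<lambda>X. {k\<in>{1..n}. X k}) (Pi_pmf {1..n} False (\<lambda>_. bernoulli_pmf p))"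

end

theory Submission
  imports Defs "HOL-Real_Asymp.Real_Asymp"
begin

text \<open>For (0), first moments show that with high probability every member of \<open>[n]\<^sub>p\<close> has at most 8 divisors
  in the set, and fewer if these share factors. A greedy colouring then succeeds: its only obstruction
  is an element \<open>a b = c d\<close> where \<open>a\<close>, \<open>b\<close> are red and \<open>c\<close>, \<open>d\<close> are blue, hence \<open>c\<close>, \<open>d\<close> factor
  further, and counting the divisors involved with multiplicity gives at least 9 of them. The function
  \<open>\<epsilon>\<close> absorbs the divisor bound and comes from a diagonal argument over fixed exponents.

  For (1), find \<open>x\<close> and then \<open>y\<close> with \<open>x\<close>, \<open>y\<close>, \<open>x y\<close> in the set, at scales \<open>n\<^bsup>1/11\<^esup>\<close> and \<open>n\<^bsup>2/11\<^esup>\<close>.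
  Each way to colour these three numbers without a monochromatic triple is refuted by 6 multiples
  of a single number at scale \<open>n\<^bsup>6/11\<^esup>\<close>. The candidates at every stage are pairwise disjoint sets,
  so the probabilities that none of them is present can be computed exactly.\<close>

section \<open>Probabilities for random subsets\<close>

lemma prob_superset:
  assumes "0 \<le> p" "p \<le> 1" "S \<subseteq> {1..n}"
  shows "measure_pmf.prob (random_subset n p) {A. S \<subseteq> A} = p ^ card S"
proof -
  have "{X. S \<subseteq> {k \<in> {1..n}. X k}} = Pi {1..n} (\<lambda>k. if k \<in> S then {True} else UNIV)"
    using assms(3) by (auto simp: Pi_def)
  then have "measure_pmf.prob (random_subset n p) {A. S \<subseteq> A} =
      (\<Prod>k\<in>{1..n}. measure_pmf.prob (bernoulli_pmf p) (if k \<in> S then {True} else UNIV))"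
    by (simp add: random_subset_def vimage_def measure_Pi_pmf_Pi)
  also have "\<dots> = (\<Prod>k\<in>{1..n}. if k \<in> S then p else 1)"
    using assms by (intro prod.cong) (auto simp: measure_pmf_single)
  also have "\<dots> = p ^ card S"
    using assms(3) by (simp add: prod.If_cases Int_absorb1)
  finally show ?thesis .
qed

text \<open>Avoiding one more copy \<open>C j\<close> turns the event into a difference of two
  events of the same shape, for \<open>S\<close> and for \<open>S\<close> enlarged by
  \<open>C j\<close>; hence the induction with \<open>S\<close> arbitrary.\<close>

lemma prob_superset_avoiding:
  assumes p: "0 \<le> p" "p \<le> 1" and I: "finite I" and "S \<subseteq> {1..n}"
    and C: "\<And>i. i \<in> I \<Longrightarrow> C i \<subseteq> {1..n}" "disjoint_family_on C I" and "\<And>i. i \<in> I \<Longrightarrow> S \<inter> C i = {}"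
  shows "measure_pmf.prob (random_subset n p) {A. S \<subseteq> A \<and> (\<forall>i\<in>I. \<not> C i \<subseteq> A)} =
    p ^ card S * (\<Prod>i\<in>I. 1 - p ^ card (C i))"
  using I assms(4-)
proof (induction I arbitrary: S rule: finite_induct)
  case empty
  then show ?case using p by (simp add: prob_superset)
next
  case (insert j I)
  let ?P = "measure_pmf.prob (random_subset n p)"
  define E where "E S = {A. S \<subseteq> A \<and> (\<forall>i\<in>I. \<not> C i \<subseteq> A)}" for S
  have disj: "disjoint_family_on C I" "\<And>i. i \<in> I \<Longrightarrow> C j \<inter> C i = {}"
    using insert.prems(3) insert.hyps by (auto simp: disjoint_family_on_def)
  have fin: "finite S" "finite (C j)"
    using insert.prems(1) insert.prems(2)[of j] finite_subset by auto
  have "{A. S \<subseteq> A \<and> (\<forall>i\<in>insert j I. \<not> C i \<subseteq> A)} = E S - E (S \<union> C j)"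
    by (auto simp: E_def)
  also have "?P \<dots> = ?P (E S) - ?P (E (S \<union> C j))"
    by (rule measure_pmf.finite_measure_Diff) (auto simp: E_def)
  also have "?P (E S) = p ^ card S * (\<Prod>i\<in>I. 1 - p ^ card (C i))"
    unfolding E_def using insert.prems disj by (intro insert.IH) simp_all
  also have "?P (E (S \<union> C j)) = p ^ card (S \<union> C j) * (\<Prod>i\<in>I. 1 - p ^ card (C i))"
    unfolding E_def using insert.prems disj by (intro insert.IH) (simp_all add: Int_Un_distrib2)
  also have "card (S \<union> C j) = card S + card (C j)"
    using fin insert.prems(4)[of j] by (intro card_Un_disjoint) auto
  finally show ?case using insert.hyps by (simp add: power_add algebra_simps)
qed

lemma prob_superset_avoiding_le:
  fixes p :: real
  assumes p: "0 \<le> p" "p \<le> 1" and I: "finite I" and "S \<subseteq> {1..n}"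
    and C: "\<And>i. i \<in> I \<Longrightarrow> C i \<subseteq> {1..n}" "disjoint_family_on C I" and "\<And>i. i \<in> I \<Longrightarrow> S \<inter> C i = {}"
    and le: "\<And>i. i \<in> I \<Longrightarrow> card (C i) \<le> r"
  shows "measure_pmf.prob (random_subset n p) {A. S \<subseteq> A \<and> (\<forall>i\<in>I. \<not> C i \<subseteq> A)} \<le>
    p ^ card S * exp (- (card I * p ^ r))"
proof -
  have "(\<Prod>i\<in>I. 1 - p ^ card (C i)) \<le> (\<Prod>i\<in>I. exp (- (p ^ r)))"
  proof (intro prod_mono conjI)
    fix i assume "i \<in> I"
    show "0 \<le> 1 - p ^ card (C i)" using p by (simp add: power_le_one)
    have "p ^ r \<le> p ^ card (C i)" using p le[OF \<open>i \<in> I\<close>] by (intro power_decreasing) auto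
    then show "1 - p ^ card (C i) \<le> exp (- (p ^ r))" using exp_ge_add_one_self[of "- (p ^ r)"] by linarith
  qed
  also have "\<dots> = exp (- (card I * p ^ r))" by (simp flip: exp_of_nat_mult)
  finally show ?thesis using p by (subst prob_superset_avoiding[OF assms(1-7)]) (auto intro: mult_left_mono)
qed

section \<open>The divisor bound\<close>

lemma card_divisors_mult_le:
  fixes a b :: nat
  assumes "a > 0" "b > 0"
  shows "card {d. d dvd a * b} \<le> card {d. d dvd a} * card {d. d dvd b}"
proof -
  have "{d. d dvd a * b} \<subseteq> (\<lambda>(x, y). x * y) ` ({d. d dvd a} \<times> {d. d dvd b})"
  proof
    fix d assume "d \<in> {d. d dvd a * b}"
    then obtain x y where "d = x * y" "x dvd a" "y dvd b" using division_decomp[of d a b] by blast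
    then show "d \<in> (\<lambda>(x, y). x * y) ` ({d. d dvd a} \<times> {d. d dvd b})"
      by (intro image_eqI[of _ _ "(x, y)"]) auto
  qed
  then have "card {d. d dvd a * b} \<le> card ({d. d dvd a} \<times> {d. d dvd b})"
    using assms by (intro surj_card_le) auto
  then show ?thesis by (simp add: card_cartesian_product)
qed

lemma card_divisors_prime_power:
  fixes p :: nat
  assumes "prime p"
  shows "card {d. d dvd p ^ k} = Suc k"
proof -
  have "{d. d dvd p ^ k} = (\<lambda>i. p ^ i) ` {..k}"
    using divides_primepow_nat[OF assms] by auto
  moreover have "inj_on (\<lambda>i. p ^ i) {..k}"
    using prime_gt_1_nat[OF assms] by (auto intro!: inj_onI)
  ultimately show ?thesis by (simp add: card_image)
qed

lemma card_divisors_prod_le: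
  fixes e :: "nat \<Rightarrow> nat"
  assumes "finite P" "\<And>p. p \<in> P \<Longrightarrow> prime p"
  shows "card {d. d dvd (\<Prod>p\<in>P. p ^ e p)} \<le> (\<Prod>p\<in>P. Suc (e p))"
  using assms
proof (induction P rule: finite_induct)
  case (insert q P)
  have "card {d. d dvd q ^ e q * (\<Prod>p\<in>P. p ^ e p)} \<le>
      card {d. d dvd q ^ e q} * card {d. d dvd (\<Prod>p\<in>P. p ^ e p)}"
    using insert.prems prime_gt_0_nat by (intro card_divisors_mult_le) (simp_all add: prod_pos)
  also have "\<dots> \<le> Suc (e q) * (\<Prod>p\<in>P. Suc (e p))"
    using insert by (auto simp: card_divisors_prime_power simp del: mult_Suc)
  finally show ?case using insert.hyps by simp
qed simp

text \<open>For a prime p with p^eta >= 2 the factor \<open>Suc e\<close> is at most (p^eta)^e; only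
  the boundedly many smaller primes lose a constant each.\<close>

lemma divisor_bound:
  fixes \<eta> :: real
  assumes "\<eta> > 0"
  obtains C where "C > 0" "\<And>m :: nat. m > 0 \<Longrightarrow> card {d. d dvd m} \<le> C * real m powr \<eta>"
proof -
  \<comment> \<open>From \<open>K\<close> on, p^eta >= 2. The loss \<open>L\<close> per smaller
    prime is chosen so that 1 + e <= L * (1 + e * eta * ln 2).\<close>
  define K where "K = nat \<lceil>2 powr (1 / \<eta>)\<rceil>"
  define L where "L = 1 + 1 / (\<eta> * ln 2)"
  have L: "L \<ge> 1" using assms by (simp add: L_def)
  have small: "real (Suc e) \<le> L * (2 powr \<eta>) ^ e" for e
  proof -
    have "1 + e * (\<eta> * ln 2) \<le> exp (e * (\<eta> * ln 2))" by (rule exp_ge_add_one_self)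
    also have "\<dots> = (2 powr \<eta>) ^ e" by (simp add: powr_def exp_of_nat_mult)
    finally have "L * (1 + e * (\<eta> * ln 2)) \<le> L * (2 powr \<eta>) ^ e" using L by (intro mult_left_mono) auto
    moreover have "real (Suc e) \<le> L * (1 + e * (\<eta> * ln 2))"
      using assms by (simp add: L_def field_simps)
    ultimately show ?thesis by linarith
  qed
  have factor: "real (Suc e) \<le> (if p < K then L else 1) * (real p powr \<eta>) ^ e" if "prime p" for p e
  proof (cases "p < K")
    case True
    have "(2 powr \<eta>) ^ e \<le> (real p powr \<eta>) ^ e"
      using prime_ge_2_nat[OF that] assms by (intro power_mono powr_mono2) auto
    then have "L * (2 powr \<eta>) ^ e \<le> L * (real p powr \<eta>) ^ e" using L by (intro mult_left_mono) auto
    then show ?thesis using True order_trans[OF small] by simp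
  next
    case False
    then have "2 powr (1 / \<eta>) \<le> real p" unfolding K_def by linarith
    then have "(2 powr (1 / \<eta>)) powr \<eta> \<le> real p powr \<eta>" using assms by (intro powr_mono2) auto
    then have "2 ^ e \<le> (real p powr \<eta>) ^ e" using assms by (intro power_mono) (auto simp: powr_powr)
    moreover have "real (Suc e) \<le> 2 ^ e" using less_exp[of e] by (metis Suc_leI of_nat_le_iff of_nat_numeral of_nat_power)
    ultimately show ?thesis using False by simp
  qed
  show ?thesis
  proof (rule that[of "L ^ K"])
    show "L ^ K > 0" using L by simp
    fix m :: nat assume m: "m > 0"
    define P where "P = prime_factors m"
    define e where "e p = multiplicity p m" for p
    have P: "finite P" "\<And>p. p \<in> P \<Longrightarrow> prime p" by (auto simp: P_def)
    have m_eq: "m = (\<Prod>p\<in>P. p ^ e p)" unfolding P_def e_def by (rule prime_factorization_nat[OF m])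
    have "real (card {d. d dvd m}) \<le> real (\<Prod>p\<in>P. Suc (e p))"
      unfolding of_nat_le_iff using card_divisors_prod_le[OF P, of e] m_eq by simp
    also have "\<dots> = (\<Prod>p\<in>P. real (Suc (e p)))" by simp
    also have "\<dots> \<le> (\<Prod>p\<in>P. (if p < K then L else 1) * (real p powr \<eta>) ^ e p)"
      using P factor by (intro prod_mono) auto
    also have "\<dots> = (\<Prod>p\<in>P. if p < K then L else 1) * (\<Prod>p\<in>P. (real p powr \<eta>) ^ e p)"
      by (rule prod.distrib)
    also have "(\<Prod>p\<in>P. (real p powr \<eta>) ^ e p) = real m powr \<eta>"
    proof -
      have "(\<Prod>p\<in>P. (real p powr \<eta>) ^ e p) = (\<Prod>p\<in>P. (real p ^ e p) powr \<eta>)"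
      proof (rule prod.cong)
        fix p assume "p \<in> P"
        then have "p > 0" using P prime_gt_0_nat by blast
        then have "real p ^ e p = real p powr real (e p)" by (simp add: powr_realpow)
        then show "(real p powr \<eta>) ^ e p = (real p ^ e p) powr \<eta>"
          using \<open>p > 0\<close> by (simp only: powr_powr) (simp add: powr_power)
      qed simp
      also have "\<dots> = (\<Prod>p\<in>P. real p ^ e p) powr \<eta>" by (rule prod_powr_distrib[symmetric])
      also have "(\<Prod>p\<in>P. real p ^ e p) = real m" by (subst m_eq) simp
      finally show ?thesis .
    qed
    also have "(\<Prod>p\<in>P. if p < K then L else 1) \<le> L ^ K"
    proof -
      have "(\<Prod>p\<in>P. if p < K then L else 1) = L ^ card (P \<inter> {p. p < K})"
        using P by (simp add: prod.If_cases)
      also have "card (P \<inter> {p. p < K}) \<le> card {..<K}" by (rule card_mono) auto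
      then have "L ^ card (P \<inter> {p. p < K}) \<le> L ^ K" using L by (intro power_increasing) auto
      finally show ?thesis .
    qed
    finally show "real (card {d. d dvd m}) \<le> L ^ K * real m powr \<eta>"
      by (simp add: mult_right_mono)
  qed
qed

section \<open>A colouring of sets with few divisors\<close>

text \<open>Irreducible elements are red; a reducible one is blue unless it is a product of two blue
  elements. So only an element \<open>a * b = c * d\<close> with \<open>a\<close>, \<open>b\<close> red and \<open>c\<close>, \<open>d\<close> blue can be the
  product in a monochromatic triple.\<close>

function red :: "nat set \<Rightarrow> nat \<Rightarrow> bool" where
  "red A v \<longleftrightarrow> (\<exists>a\<in>A. \<exists>b\<in>A. v = a * b) \<longrightarrow>
     (\<exists>a\<in>A \<inter> {..<v}. \<exists>b\<in>A \<inter> {..<v}. v = a * b \<and> \<not> red A a \<and> \<not> red A b)"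
  by pat_completeness auto
termination by (relation "Wellfounded.measure snd") auto

declare red.simps [simp del]

lemma square_eq_mult_between:
  fixes a c d :: nat
  assumes "a * a = c * d" "d < c" "0 < d"
  shows "d < a" "a < c"
proof -
  have "d * d < a * a" "a * a < c * c"
    unfolding assms(1) using assms(2,3) by simp_all
  then show "d < a" "a < c" by (metis mult_le_mono not_less)+
qed

text \<open>Bookkeeping for repetitions: a new entry multiplies both sides by
  \<open>n * x ^ k\<close>, a repeated one multiplies the left by \<open>n\<close> and the right by
  \<open>x ^ k\<close>, which is no smaller.\<close>

lemma power_length_le_prod_list:
  fixes n :: nat
  assumes "\<And>x. x \<in> set xs \<Longrightarrow> n \<le> x ^ k"
  shows "n ^ length xs * (\<Prod>x\<in>set xs. x) ^ k \<le> prod_list xs ^ k * n ^ card (set xs)"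
  using assms
proof (induction xs)
  case (Cons x xs)
  then have IH: "n ^ length xs * (\<Prod>x\<in>set xs. x) ^ k \<le> prod_list xs ^ k * n ^ card (set xs)"
    and x: "n \<le> x ^ k" by auto
  show ?case
  proof (cases "x \<in> set xs")
    case True
    then show ?thesis using mult_mono[OF x IH] by (simp add: insert_absorb power_mult_distrib mult_ac)
  next
    case False
    then show ?thesis using mult_left_mono[OF IH, of "n * x ^ k"]
      by (simp add: power_mult_distrib mult_ac)
  qed
qed simp

lemma prod_list_dvd_power_length:
  fixes k :: nat
  assumes "\<And>x. x \<in> set xs \<Longrightarrow> x dvd k"
  shows "prod_list xs dvd k ^ length xs"
  using assms by (induction xs) (auto intro: mult_dvd_mono)

text \<open>Each \<open>k \<le> n\<close> has \<open>n\<^bsup>o(1)\<^esup>\<close> sets \<open>T\<close> of at most 9 divisors of \<open>k ^ 9\<close>. For \<open>p\<close> below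
  \<open>n\<^bsup>-1/9\<^esup>\<close> such a \<open>T\<close> with \<open>n ^ card T \<ge> k ^ 9\<close> lies in the random set with probability less
  than \<open>1 / k\<close> by a power of \<open>n\<close>, so no such \<open>T\<close> is expected to occur. Divisors of \<open>k ^ 9\<close> rather
  than \<open>k\<close> allow \<open>k\<close> to be the product of the distinct factors of an element with repeated ones.\<close>

locale sparse_divisors =
  fixes A :: "nat set" and n :: nat
  assumes subset: "A \<subseteq> {1..n}"
    and sparse: "\<And>T k. T \<subseteq> A \<Longrightarrow> T \<noteq> {} \<Longrightarrow> k \<in> {1..n} \<Longrightarrow> (\<And>t. t \<in> T \<Longrightarrow> t dvd k ^ 9) \<Longrightarrow> n ^ card T < k ^ 9"
begin

section \<open>Divisor counts in a sparse set\<close>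

lemma finite_A: "finite A"
  using subset finite_subset by blast

lemma le_n: "x \<in> A \<Longrightarrow> x \<le> n"
  using subset by auto

lemma less_power: "x \<in> A \<Longrightarrow> n < x ^ 9"
  using sparse[of "{x}" x] subset by auto

lemma ge_2: assumes "x \<in> A" shows "x \<ge> 2"
proof -
  have "x \<noteq> 0" "x \<noteq> 1" "x \<le> n" using assms subset less_power[OF assms] by auto
  then show ?thesis by auto
qed

lemma mult_less:
  assumes "a \<in> A" "b \<in> A" shows "a < a * b" "b < a * b"
  using ge_2[OF assms(1)] ge_2[OF assms(2)] by auto

text \<open>Members of \<open>A\<close> exceed n^(1/9), so \<open>xs\<close> has at most 9 entries
  and its product divides k^9, where k is the product of the distinct entries. Sparsity at k bounds
  \<open>E\<close> together with the distinct entries, and each repetition uses up a further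
  n^(1/9). Thus entries count with multiplicity.\<close>

lemma divisor_count:
  assumes xs: "set xs \<subseteq> A" "xs \<noteq> []" "prod_list xs \<in> A"
    and E: "E \<subseteq> A" "E \<inter> set xs = {}" "\<And>e. e \<in> E \<Longrightarrow> e dvd prod_list xs"
  shows "card E + length xs \<le> 8"
proof -
  define v where "v = prod_list xs"
  define k where "k = (\<Prod>x\<in>set xs. x)"
  have v: "v \<le> n" "v \<ge> 2" using xs le_n ge_2 by (auto simp: v_def)
  then have n: "n \<ge> 2" by simp
  have len: "n ^ length xs \<le> v ^ 9" unfolding v_def using xs(1)
  proof (induction xs)
    case (Cons x xs)
    then have "n * n ^ length xs \<le> x ^ 9 * prod_list xs ^ 9"
      by (intro mult_mono) (use less_power[of x] in auto)
    then show ?case by (simp add: power_mult_distrib)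
  qed simp
  also have "\<dots> \<le> n ^ 9" using v by (intro power_mono) auto
  finally have l9: "length xs \<le> 9" using n by (simp add: power_increasing_iff)
  have xk: "x dvd k" if "x \<in> set xs" for x unfolding k_def using that by (intro dvd_prodI) auto
  have vk: "v dvd k ^ 9"
    unfolding v_def by (rule dvd_trans[OF prod_list_dvd_power_length le_imp_power_dvd[OF l9]]) (rule xk)
  have "k dvd v" unfolding k_def v_def
    by (induction xs) (auto simp: insert_absorb prod.insert_if intro: mult_dvd_mono)
  then have kn: "k \<in> {1..n}"
    using v dvd_imp_le[of k v] dvd_pos_nat[of v k] by auto
  have "n ^ card (E \<union> set xs) < k ^ 9"
  proof (rule sparse)
    show "t dvd k ^ 9" if "t \<in> E \<union> set xs" for t
      using that E(3) vk xk dvd_trans[of t k "k ^ 9"] dvd_trans[of t v "k ^ 9"] by (auto simp: v_def)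
  qed (use xs E kn in auto)
  moreover have "card (E \<union> set xs) = card E + card (set xs)"
    using E finite_A finite_subset[of E A] by (intro card_Un_disjoint) auto
  ultimately have lt: "n ^ card E * n ^ card (set xs) < k ^ 9" by (simp add: power_add)
  have "n ^ length xs * k ^ 9 \<le> v ^ 9 * n ^ card (set xs)"
    unfolding k_def v_def using xs less_power by (intro power_length_le_prod_list) (auto intro: less_imp_le)
  then have "n ^ card E * (n ^ length xs * k ^ 9) \<le> n ^ card E * (v ^ 9 * n ^ card (set xs))"
    by simp
  also have "\<dots> = v ^ 9 * (n ^ card E * n ^ card (set xs))" by simp
  also have "\<dots> < v ^ 9 * k ^ 9" using lt v by simp
  finally have "n ^ (card E + length xs) < v ^ 9"
    by (simp add: power_add mult.assoc[symmetric])
  also have "\<dots> \<le> n ^ 9" using v by (intro power_mono) auto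
  finally show ?thesis using n by (simp add: power_strict_increasing_iff)
qed

text \<open>The root \<open>x\<close> can serve as k in the sparsity condition, since divisors of
  x^2 divide x^9. As x <= n^(1/2), the bound 9 is halved.\<close>

lemma divisor_count_square:
  assumes "x ^ 2 \<in> A" "E \<subseteq> A" "\<And>e. e \<in> E \<Longrightarrow> e dvd x ^ 2"
  shows "card E \<le> 4"
proof (cases "E = {}")
  case False
  have x: "x ^ 2 \<le> n" "2 \<le> x ^ 2" using assms(1) le_n ge_2 by auto
  then have "x \<in> {1..n}" by (cases x) (auto intro: le_trans[OF power2_nat_le_imp_le])
  moreover have "e dvd x ^ 9" if "e \<in> E" for e
    using assms(3)[OF that] le_imp_power_dvd[of 2 9 x] dvd_trans by auto
  ultimately have "n ^ card E < x ^ 9"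
    using False assms by (intro sparse) auto
  then have "(n ^ card E) ^ 2 < (x ^ 9) ^ 2" by (intro power_strict_mono) auto
  also have "\<dots> = (x ^ 2) ^ 9" by simp
  also have "\<dots> \<le> n ^ 9" using x by (intro power_mono) auto
  finally have "n ^ (2 * card E) < n ^ 9" by (simp add: power_mult[symmetric] mult.commute)
  then show ?thesis using x by (simp add: power_strict_increasing_iff)
qed simp

section \<open>Irreducible elements and the exclusion of clashes\<close>

definition reducible :: "nat \<Rightarrow> bool" where
  "reducible x \<longleftrightarrow> (\<exists>a\<in>A. \<exists>b\<in>A. x = a * b)"

text \<open>Factors from \<open>A\<close> are smaller than their product, so the bounds that make
  the recursion terminate disappear.\<close>

lemma red_iff: "red A v \<longleftrightarrow>
    (reducible v \<longrightarrow> (\<exists>a\<in>A. \<exists>b\<in>A. v = a * b \<and> \<not> red A a \<and> \<not> red A b))"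
proof -
  have "(\<exists>a\<in>A. \<exists>b\<in>A. v = a * b \<and> \<not> red A a \<and> \<not> red A b) \<longleftrightarrow>
      (\<exists>a\<in>A \<inter> {..<v}. \<exists>b\<in>A \<inter> {..<v}. v = a * b \<and> \<not> red A a \<and> \<not> red A b)"
    using mult_less by (metis IntD1 IntI lessThan_iff)
  then show ?thesis
    unfolding reducible_def by (simp add: red.simps[of A v])
qed

lemma irreducible_list:
  "x \<in> A \<Longrightarrow> \<exists>xs. set xs \<subseteq> {y \<in> A. \<not> reducible y} \<and> prod_list xs = x \<and> xs \<noteq> [] \<and> (reducible x \<longrightarrow> length xs \<ge> 2)"
proof (induction x rule: less_induct)
  case (less x)
  show ?case
  proof (cases "reducible x")
    case True
    then obtain a b where ab: "a \<in> A" "b \<in> A" "x = a * b" by (auto simp: reducible_def)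
    with less.IH[of a] less.IH[of b] mult_less[of a b] obtain xs ys where
      "set xs \<subseteq> {y \<in> A. \<not> reducible y}" "prod_list xs = a" "xs \<noteq> []"
      "set ys \<subseteq> {y \<in> A. \<not> reducible y}" "prod_list ys = b" "ys \<noteq> []" by auto
    with ab show ?thesis
      by (intro exI[of _ "xs @ ys"]) (auto simp: Suc_le_eq neq_Nil_conv)
  qed (use less.prems in \<open>auto intro!: exI[of _ "[x]"]\<close>)
qed

text \<open>If \<open>x\<close> were one of the factors of \<open>c\<close>, cancelling it would
  exhibit \<open>y\<close> as the product of the other factor and \<open>d\<close>.\<close>

lemma irreducible_neq:
  assumes "x * y = c * d" "c = c1 * c2" "c1 \<in> A" "c2 \<in> A" "d \<in> A" "\<not> reducible y"
  shows "x \<noteq> c1" "x \<noteq> c2"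
proof -
  have "c1 * y \<noteq> c1 * (c2 * d)" "c2 * y \<noteq> c2 * (c1 * d)"
    using assms(3-6) ge_2[of c1] ge_2[of c2] by (auto simp: reducible_def)
  then show "x \<noteq> c1" "x \<noteq> c2" using assms(1,2) by (metis mult.assoc mult.commute)+
qed

text \<open>If \<open>d\<close> is a factor of \<open>c\<close>, it cannot count both as a divisor
  and as a list entry. Splitting it gives a * b = (d1 * d2)^2 * c2, with 4 divisors plus 5 entries,
  or (d1 * d2)^3 if c2 = d, with 3 divisors plus 6 entries. Both totals are 9.\<close>

lemma no_clash_irreducible_overlap:
  assumes A: "a \<in> A" "b \<in> A" "c \<in> A" "d \<in> A" "a * b \<in> A" and eq: "a * b = c * d"
    and ne: "a \<noteq> c" "a \<noteq> d"
    and c: "c = d * c2" and d: "d = d1 * d2" and A': "c2 \<in> A" "d1 \<in> A" "d2 \<in> A"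
    and nin: "a \<notin> {c2, d1, d2}"
  shows False
proof -
  have less: "a < a * b" "c < a * b" "d < c" "c2 < c" "d1 < d" "d2 < d"
    using mult_less A A' eq c d by metis+
  have dv: "a * b dvd a * b" "a dvd a * b" "b dvd a * b" "c dvd a * b" "d dvd a * b"
    by (simp_all, simp_all add: eq)
  show False
  proof (cases "c2 = d")
    case True
    have "card {a * b, c, d} + length [d1, d2, d1, d2, d1, d2] \<le> 8"
      by (rule divisor_count) (use less A A' in \<open>auto simp: eq c d True mult_ac\<close>)
    then show False using less by simp
  next
    case False
    have "card {a * b, a, c, d} + length [d1, d2, d1, d2, c2] \<le> 8"
    proof (rule divisor_count)
      have p: "prod_list [d1, d2, d1, d2, c2] = a * b"
        by (simp add: eq c d mult_ac)
      show "prod_list [d1, d2, d1, d2, c2] \<in> A" using p A by simp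
      show "e dvd prod_list [d1, d2, d1, d2, c2]" if "e \<in> {a * b, a, c, d}" for e
        unfolding p using that dv by blast
    qed (use less A A' False nin in auto)
    then show False using less ne by simp
  qed
qed

text \<open>The 5 divisors \<open>a * b\<close>, \<open>a\<close>, \<open>b\<close>,
  \<open>c\<close>, \<open>d\<close> and the 4 factors of \<open>c\<close> and \<open>d\<close>
  total 9. The work lies in disjointness: irreducibility keeps \<open>a\<close> and \<open>b\<close>
  from being factors, and the preceding lemma excludes factors equal to \<open>c\<close> or
  \<open>d\<close>.\<close>

lemma no_clash_irreducible:
  assumes A: "a \<in> A" "b \<in> A" "c \<in> A" "d \<in> A" "a * b \<in> A" and eq: "a * b = c * d"
    and ne: "a \<noteq> b" "c \<noteq> d" "a \<notin> {c, d}" "b \<notin> {c, d}"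
    and irr: "\<not> reducible a" "\<not> reducible b" and red: "reducible c" "reducible d"
  shows False
proof -
  obtain c1 c2 d1 d2 where A': "c1 \<in> A" "c2 \<in> A" "d1 \<in> A" "d2 \<in> A"
    and c: "c = c1 * c2" and d: "d = d1 * d2"
    using red by (auto simp: reducible_def)
  have eq': "b * a = c * d" "a * b = d * c" "b * a = d * c" using eq by (simp_all add: mult_ac)
  have nin: "a \<notin> {c1, c2, d1, d2}" "b \<notin> {c1, c2, d1, d2}"
    using irreducible_neq[OF eq c] irreducible_neq[OF eq'(1) c]
      irreducible_neq[OF eq'(2) d] irreducible_neq[OF eq'(3) d] A A' irr by auto
  have less: "a < a * b" "b < a * b" "c < a * b" "d < a * b" "c1 < c" "c2 < c" "d1 < d" "d2 < d"
    using mult_less A A' eq c d by metis+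
  have "c1 \<noteq> d" using no_clash_irreducible_overlap[OF A eq _ _ _ d] ne c A' nin by auto
  moreover have "c2 \<noteq> d"
    using no_clash_irreducible_overlap[OF A eq _ _ _ d, of c1] ne c A' nin by (auto simp: mult.commute)
  moreover have "d1 \<noteq> c"
    using no_clash_irreducible_overlap[OF A(1,2,4,3,5) eq'(2) _ _ _ c, of d2] ne d A' nin by auto
  moreover have "d2 \<noteq> c"
    using no_clash_irreducible_overlap[OF A(1,2,4,3,5) eq'(2) _ _ _ c, of d1] ne d A' nin
    by (auto simp: mult.commute)
  ultimately have ne': "c1 \<noteq> d" "c2 \<noteq> d" "d1 \<noteq> c" "d2 \<noteq> c" by blast+
  have dv: "a * b dvd a * b" "a dvd a * b" "b dvd a * b" "c dvd a * b" "d dvd a * b"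
    by (simp_all, simp_all add: eq)
  have "card {a * b, a, b, c, d} + length [c1, c2, d1, d2] \<le> 8"
  proof (rule divisor_count)
    have p: "prod_list [c1, c2, d1, d2] = a * b"
      by (simp add: eq c d mult_ac)
    show "prod_list [c1, c2, d1, d2] \<in> A" using p A by simp
    show "e dvd prod_list [c1, c2, d1, d2]" if "e \<in> {a * b, a, b, c, d}" for e
      unfolding p using that dv by blast
  qed (use less A A' ne' nin in auto)
  then show False using less ne by simp
qed

text \<open>Irreducible factors are counted: at least 1 from \<open>a\<close> and 2 from each of
  \<open>e\<close> and \<open>f\<close>. The 4 divisors \<open>a * b\<close>, \<open>b\<close>,
  \<open>c\<close>, \<open>d\<close> are reducible, hence different from these, and the total
  reaches 9.\<close>

lemma no_clash_reducible:
  assumes A: "a \<in> A" "b \<in> A" "c \<in> A" "d \<in> A" "a * b \<in> A" and eq: "a * b = c * d"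
    and ne: "c \<noteq> d" "b \<notin> {c, d}"
    and red: "reducible c" "reducible d"
    and b: "b = e * f" "e \<in> A" "f \<in> A" "reducible e" "reducible f"
  shows False
proof -
  obtain xs ys zs where lists:
    "set xs \<subseteq> {y \<in> A. \<not> reducible y}" "prod_list xs = a" "xs \<noteq> []"
    "set ys \<subseteq> {y \<in> A. \<not> reducible y}" "prod_list ys = e" "length ys \<ge> 2"
    "set zs \<subseteq> {y \<in> A. \<not> reducible y}" "prod_list zs = f" "length zs \<ge> 2"
    using irreducible_list[of a] irreducible_list[of e] irreducible_list[of f] A b by blast
  have p: "prod_list (xs @ ys @ zs) = a * b" using lists b by simp
  have less: "b < a * b" "c < a * b" "d < a * b"
    using mult_less A eq by metis+
  have dv: "a * b dvd a * b" "a dvd a * b" "b dvd a * b" "c dvd a * b" "d dvd a * b"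
    by (simp_all, simp_all add: eq)
  have "reducible b" "reducible (a * b)" using A b by (auto simp: reducible_def)
  then have "card {a * b, b, c, d} + length (xs @ ys @ zs) \<le> 8"
  proof (intro divisor_count)
    show "prod_list (xs @ ys @ zs) \<in> A" using p A by simp
    show "e dvd prod_list (xs @ ys @ zs)" if "e \<in> {a * b, b, c, d}" for e
      unfolding p using that dv by blast
  qed (use lists A red in auto)
  moreover have "card {a * b, b, c, d} = 4" using less ne by simp
  moreover have "length xs \<ge> 1" using lists by (cases xs) auto
  ultimately show False using lists by simp
qed

text \<open>The chain d1 < d < a < c < a * a consists of five divisors of a square.\<close>

lemma no_clash_square_left:
  assumes A: "a \<in> A" "c \<in> A" "d \<in> A" "a * a \<in> A" and eq: "a * a = c * d"
    and less: "d < c" and d: "d = d1 * d2" "d1 \<in> A" "d2 \<in> A"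
  shows False
proof -
  have "d < a" "a < c"
    using square_eq_mult_between[OF eq less] ge_2[OF A(3)] by auto
  moreover have "d1 < d" "c < a * a" using mult_less A d eq by metis+
  moreover have "c dvd a * a" "d dvd a * a" "d1 dvd a * a" by (simp_all add: eq d)
  then have "card {a * a, a, c, d, d1} \<le> 4"
    by (intro divisor_count_square[of a]) (use A d in \<open>auto simp: power2_eq_square\<close>)
  ultimately show False by simp
qed

text \<open>Since \<open>c * c\<close>, \<open>a\<close>, \<open>b\<close>, \<open>c\<close> are
  four divisors of a square, there is no fifth in \<open>A\<close>. This forces c = a^2 and b = a^3,
  and then a splitting of \<open>b\<close> without \<open>a\<close> has both factors equal to
  \<open>c\<close>, which is too large. Such a splitting exists for a red reducible \<open>b\<close>
  because its factors are blue while \<open>a\<close> is red.\<close>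

lemma no_clash_square_right:
  assumes A: "a \<in> A" "b \<in> A" "c \<in> A" "c * c \<in> A" and eq: "a * b = c * c"
    and less: "a < b" and c: "c = c1 * c2" "c1 \<in> A" "c2 \<in> A"
    and b: "reducible b \<Longrightarrow> \<exists>e\<in>A. \<exists>f\<in>A. b = e * f \<and> e \<noteq> a \<and> f \<noteq> a"
  shows False
proof -
  have ord: "a < c" "c < b"
    using square_eq_mult_between[of c b a] less eq ge_2[OF A(1)] by (auto simp: mult.commute)
  have "b < c * c" "c1 < c" "c2 < c" using mult_less A c eq by metis+
  have *: False if "e \<in> A" "e \<notin> {c * c, a, b, c}" "e dvd c * c" for e
  proof -
    have "a dvd c * c" "b dvd c * c" by (simp_all flip: eq)
    then have "card {c * c, a, b, c, e} \<le> 4"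
      by (intro divisor_count_square[of c]) (use A that in \<open>auto simp: power2_eq_square\<close>)
    moreover have "e \<notin> {c * c, a, b, c}" "a \<notin> {c * c, b, c}" "b \<notin> {c * c, c}" "c \<noteq> c * c"
      using that ord \<open>b < c * c\<close> by auto
    ultimately show False by (auto simp: card_insert_if)
  qed
  have c12: "c1 = a" "c2 = a" using *[of c1] *[of c2] c ord \<open>b < c * c\<close> \<open>c1 < c\<close> \<open>c2 < c\<close>
    by (auto intro: dvd_trans[of _ c])
  have "a * b = a * (a * c)" unfolding eq by (simp add: c(1) c12)
  then have "b = a * c" using ge_2[OF A(1)] by auto
  then obtain e f where ef: "e \<in> A" "f \<in> A" "b = e * f" "e \<noteq> a" "f \<noteq> a"
    using A b unfolding reducible_def by blast
  have "e < b" "f < b" using ef mult_less by auto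
  have "e dvd c * c" "f dvd c * c" using ef eq dvd_trans[of _ b "c * c"] by (auto simp flip: eq)
  then have "e = c" "f = c" using *[of e] *[of f] ef \<open>e < b\<close> \<open>f < b\<close> \<open>b < c * c\<close> by auto
  then show False using \<open>b = a * c\<close> ef ord by simp
qed

text \<open>Blue elements are reducible, and a reducible red element splits into two blue, hence
  again reducible, ones. The cases are a square on either side, \<open>a\<close> or \<open>b\<close>
  reducible, and both irreducible.\<close>

lemma no_clash:
  assumes A: "a \<in> A" "b \<in> A" "c \<in> A" "d \<in> A" "a * b \<in> A" and eq: "a * b = c * d"
    and col: "red A a" "red A b" "\<not> red A c" "\<not> red A d"
  shows False
proof -
  have ne: "a \<notin> {c, d}" "b \<notin> {c, d}" using col by auto
  have rcd: "reducible c" "reducible d" using col red_iff by blast+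
  have split: "\<exists>e\<in>A. \<exists>f\<in>A. x = e * f \<and> \<not> red A e \<and> \<not> red A f" if "red A x" "reducible x" for x
    using red_iff[of x] that by blast
  consider (sqa) "a = b" | (sqc) "a \<noteq> b" "c = d" | (b) "a \<noteq> b" "c \<noteq> d" "reducible b"
    | (a) "a \<noteq> b" "c \<noteq> d" "reducible a" | (irr) "a \<noteq> b" "c \<noteq> d" "\<not> reducible a" "\<not> reducible b" by blast
  then show False
  proof cases
    case sqa
    \<comment> \<open>If \<open>c = d\<close> too, equal squares would give \<open>a = c\<close>,
      against the colours.\<close>
    then have "c \<noteq> d" using eq ne by (metis insert_iff mult_eq_self_implies_10 power2_eq_iff_nonneg power2_eq_square zero_le)
    then consider "d < c" | "c < d" by linarith
    then show False
    proof cases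
      case 1
      obtain d1 d2 where "d = d1 * d2" "d1 \<in> A" "d2 \<in> A" using rcd by (auto simp: reducible_def)
      then show False using no_clash_square_left[of a c d d1 d2] 1 A eq sqa by simp
    next
      case 2
      obtain c1 c2 where "c = c1 * c2" "c1 \<in> A" "c2 \<in> A" using rcd by (auto simp: reducible_def)
      then show False using no_clash_square_left[of a d c c1 c2] 2 A eq sqa by (simp add: mult.commute)
    qed
  next
    case sqc
    obtain c1 c2 where c: "c = c1 * c2" "c1 \<in> A" "c2 \<in> A" using rcd by (auto simp: reducible_def)
    have cc: "c * c \<in> A" "a * b = c * c" "b * a = c * c" using A eq sqc by (simp_all add: mult.commute)
    have "a < b \<or> b < a" using sqc by linarith
    then show False
    proof
      assume "a < b"
      show False
        by (rule no_clash_square_right[OF A(1-3) cc(1,2) \<open>a < b\<close> c]) (use split[of b] col in metis)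
    next
      assume "b < a"
      show False
        by (rule no_clash_square_right[OF A(2,1,3) cc(1,3) \<open>b < a\<close> c]) (use split[of a] col in metis)
    qed
  next
    case b
    then obtain e f where ef: "e \<in> A" "f \<in> A" "b = e * f" "\<not> red A e" "\<not> red A f"
      using split col by blast
    then have "reducible e" "reducible f" using red_iff by blast+
    then show False using no_clash_reducible[OF A eq _ _ rcd, of e f] b ef ne by auto
  next
    case a
    then obtain e f where ef: "e \<in> A" "f \<in> A" "a = e * f" "\<not> red A e" "\<not> red A f"
      using split col by blast
    then have "reducible e" "reducible f" using red_iff by blast+
    then show False using no_clash_reducible[of b a c d e f] A eq rcd a ef ne
      by (auto simp: mult.commute)
  next
    case irr
    then show False using no_clash_irreducible[OF A eq] rcd ne by auto
  qed
qed

lemma not_product_Schur: "\<not> product_Schur A"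
proof
  assume "product_Schur A"
  then obtain a b where ab: "a \<in> A" "b \<in> A" "a * b \<in> A"
    and eq: "red A a = red A b" "red A b = red A (a * b)"
    unfolding product_Schur_def by blast
  then have "reducible (a * b)" by (auto simp: reducible_def)
  show False
  proof (cases "red A a")
    case True
    then obtain c d where "c \<in> A" "d \<in> A" "a * b = c * d" "\<not> red A c" "\<not> red A d"
      using red_iff[of "a * b"] eq \<open>reducible (a * b)\<close> by blast
    then show False using no_clash[of a b c d] ab eq True by simp
  next
    case False
    then show False using red_iff[of "a * b"] eq ab by blast
  qed
qed

end

section \<open>Below the threshold\<close>

text \<open>Union bound over \<open>k\<close> and the forbidden sets \<open>T\<close>: each has
  probability at most n^(-delta) / k, there are at most C^9 * n^(81 * eta) of them per
  \<open>k\<close>, and the harmonic sum gives the logarithm.\<close>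

lemma prob_product_Schur_le:
  fixes p \<delta> \<eta> C :: real
  assumes n: "n \<ge> 1" and \<delta>: "\<delta> > 0" and p: "0 \<le> p" "p \<le> 1" "p \<le> real n powr (- (1 / 9) - \<delta>)"
    and \<eta>: "\<eta> > 0" and C: "C > 0" "\<And>m. m > 0 \<Longrightarrow> card {d. d dvd m} \<le> C * real m powr \<eta>"
  shows "measure_pmf.prob (random_subset n p) {A. product_Schur A}
    \<le> C ^ 9 * real n powr (81 * \<eta> - \<delta>) * (1 + ln (real n))"
proof -
  let ?P = "measure_pmf.prob (random_subset n p)"
  define D where "D k = {t. t dvd k ^ 9}" for k :: nat
  define F where "F k = {T. T \<subseteq> D k \<inter> {1..n} \<and> T \<noteq> {} \<and> card T \<le> 9 \<and> k ^ 9 \<le> n ^ card T}" for k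
  have fin: "finite (F k)" for k unfolding F_def by (rule finite_subset[of _ "Pow {1..n}"]) auto
  have "?P {A. product_Schur A} \<le> ?P (\<Union>k\<in>{1..n}. \<Union>T\<in>F k. {A. T \<subseteq> A})"
  proof (rule measure_pmf.finite_measure_mono_AE)
    have "A \<in> (\<Union>k\<in>{1..n}. \<Union>T\<in>F k. {A. T \<subseteq> A})"
      if A: "A \<in> set_pmf (random_subset n p)" "product_Schur A" for A
    proof (rule ccontr)
      assume out: "A \<notin> (\<Union>k\<in>{1..n}. \<Union>T\<in>F k. {A. T \<subseteq> A})"
      have sub: "A \<subseteq> {1..n}" using A(1) by (auto simp: random_subset_def)
      have "sparse_divisors A n"
      proof
        fix T k assume T: "T \<subseteq> A" "T \<noteq> {}" "k \<in> {1..n}" "\<And>t. t \<in> T \<Longrightarrow> t dvd k ^ 9"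
        have finT: "finite T" using T(1) sub by (meson finite_atLeastAtMost finite_subset)
        show "n ^ card T < k ^ 9"
        proof (cases "card T \<le> 9")
          case True
          then have "T \<notin> F k" using out T by blast
          then show ?thesis using T sub True by (force simp: F_def D_def)
        next
          case False
          \<comment> \<open>A larger \<open>T\<close> contains a 9-element subset, which is itself
            forbidden because k^9 <= n^9.\<close>
          then obtain T' where T': "T' \<subseteq> T" "card T' = 9"
            by (metis obtain_subset_with_card_n nat_le_linear)
          then have "T' \<in> F k"
            using T sub by (auto simp: F_def D_def intro: power_mono)
          then show ?thesis using out T T' by blast
        qed
      qed (use sub in auto)
      then show False using A(2) sparse_divisors.not_product_Schur by blast
    qed
    then show "AE A in random_subset n p. A \<in> {A. product_Schur A} \<longrightarrow>
        A \<in> (\<Union>k\<in>{1..n}. \<Union>T\<in>F k. {A. T \<subseteq> A})"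
      by (auto simp: AE_measure_pmf_iff)
  qed auto
  also have "\<dots> \<le> (\<Sum>k\<in>{1..n}. ?P (\<Union>T\<in>F k. {A. T \<subseteq> A}))"
    by (rule measure_pmf.finite_measure_subadditive_finite) auto
  also have "\<dots> \<le> (\<Sum>k\<in>{1..n}. \<Sum>T\<in>F k. ?P {A. T \<subseteq> A})"
    using fin by (intro sum_mono measure_pmf.finite_measure_subadditive_finite) auto
  also have "\<dots> \<le> (\<Sum>k\<in>{1..n}. \<Sum>T\<in>F k. real n powr - \<delta> / k)"
  proof (intro sum_mono)
    fix k T assume k: "k \<in> {1..n}" and T: "T \<in> F k"
    have c: "card T \<ge> 1"
    proof -
      have "finite T" using T finite_subset[of T "{1..n}"] by (auto simp: F_def)
      then show ?thesis using T by (simp add: F_def card_gt_0_iff Suc_le_eq)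
    qed
    have "k ^ 9 \<le> n ^ card T" using T by (simp add: F_def)
    then have "real k ^ 9 \<le> real n ^ card T" by (metis of_nat_le_iff of_nat_power)
    then have "(real k ^ 9) powr (1 / 9) \<le> (real n ^ card T) powr (1 / 9)" by (rule powr_mono2[rotated 2]) simp_all
    moreover have "real k ^ 9 = real k powr 9" using k powr_realpow[of "real k" 9] by simp
    moreover have "real n ^ card T = real n powr card T" using n powr_realpow[of "real n"] by simp
    \<comment> \<open>This is where the exponent 1/9 enters: the factor n^(-card T / 9) of the
      probability is at most 1 / k.\<close>
    ultimately have k_le: "real k \<le> real n powr (card T / 9)" using k by (simp only: powr_powr) simp
    have "?P {A. T \<subseteq> A} = p ^ card T" using p T by (intro prob_superset) (auto simp: F_def)
    also have "\<dots> \<le> (real n powr (- (1 / 9) - \<delta>)) ^ card T" using p by (intro power_mono) auto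
    also have "\<dots> = real n powr (card T * (- (1 / 9) - \<delta>))" using n by (simp add: powr_power mult.commute)
    also have "\<dots> = real n powr (- \<delta> * card T) / real n powr (card T / 9)"
    proof -
      have "card T * (- (1 / 9) - \<delta>) = - \<delta> * card T - card T / 9" by (simp add: algebra_simps)
      then show ?thesis by (simp only: powr_diff)
    qed
    also have "\<dots> \<le> real n powr - \<delta> / k"
    proof (rule frac_le)
      show "real n powr (- \<delta> * card T) \<le> real n powr - \<delta>" using n \<delta> c by (intro powr_mono) auto
    qed (use k k_le in auto)
    finally show "?P {A. T \<subseteq> A} \<le> real n powr - \<delta> / k" .
  qed
  also have "\<dots> \<le> (\<Sum>k\<in>{1..n}. C ^ 9 * real n powr (81 * \<eta>) * (real n powr - \<delta> / k))"
  proof (intro sum_mono)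
    fix k assume k: "k \<in> {1..n}"
    have finD: "finite (D k)" unfolding D_def using k by simp
    have "F k \<subseteq> set ` {xs. set xs \<subseteq> D k \<and> length xs = 9}"
    proof
      fix T assume T: "T \<in> F k"
      then have "finite T" using finite_subset[of T "{1..n}"] by (auto simp: F_def)
      then obtain xs where xs: "set xs = T" "length xs = card T" by (metis distinct_card finite_distinct_list)
      then have "xs \<noteq> []" "length xs \<le> 9" "set xs \<subseteq> D k" using T by (auto simp: F_def)
      \<comment> \<open>Padding with the first entry gives length exactly 9, so the lists number
        \<open>card (D k) ^ 9\<close>.\<close>
      then have "set (xs @ replicate (9 - length xs) (hd xs)) = T" "length (xs @ replicate (9 - length xs) (hd xs)) = 9"
        using xs by (auto simp: set_replicate_conv_if)
      then show "T \<in> set ` {xs. set xs \<subseteq> D k \<and> length xs = 9}"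
        using \<open>set xs \<subseteq> D k\<close> xs(1) by (intro image_eqI[of _ _ "xs @ replicate (9 - length xs) (hd xs)"]) auto
    qed
    then have "card (F k) \<le> card {xs. set xs \<subseteq> D k \<and> length xs = 9}"
      using finD by (intro surj_card_le finite_lists_length_eq)
    then have "card (F k) \<le> card (D k) ^ 9" using finD by (simp add: card_lists_length_eq)
    then have "real (card (F k)) \<le> real (card (D k)) ^ 9" by (metis of_nat_le_iff of_nat_power)
    also have "\<dots> \<le> (C * real (k ^ 9) powr \<eta>) ^ 9"
      unfolding D_def using k C(2)[of "k ^ 9"] by (intro power_mono) auto
    also have "\<dots> \<le> (C * real (n ^ 9) powr \<eta>) ^ 9"
      using k C \<eta> by (intro power_mono mult_left_mono powr_mono2) (auto intro: power_mono)
    also have "\<dots> = C ^ 9 * real n powr (81 * \<eta>)"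
    proof -
      have e9: "real (n ^ 9) = real n powr 9" using n powr_realpow[of "real n" 9] by simp
      have "(real (n ^ 9) powr \<eta>) ^ 9 = real n powr (81 * \<eta>)"
        unfolding e9 powr_powr using n by (simp add: powr_power)
      then show ?thesis by (simp add: power_mult_distrib)
    qed
    finally have "real (card (F k)) \<le> C ^ 9 * real n powr (81 * \<eta>)" .
    then have "real (card (F k)) * (real n powr - \<delta> / k) \<le> C ^ 9 * real n powr (81 * \<eta>) * (real n powr - \<delta> / k)"
      by (rule mult_right_mono) simp
    then show "(\<Sum>T\<in>F k. real n powr - \<delta> / k) \<le> C ^ 9 * real n powr (81 * \<eta>) * (real n powr - \<delta> / k)" by simp
  qed
  also have "\<dots> = C ^ 9 * real n powr (81 * \<eta> - \<delta>) * (\<Sum>k\<in>{1..n}. 1 / k)"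
    unfolding sum_distrib_left by (intro sum.cong refl) (simp add: powr_diff powr_minus divide_inverse)
  also have "\<dots> \<le> C ^ 9 * real n powr (81 * \<eta> - \<delta>) * (1 + ln (real n))"
  proof (rule mult_left_mono)
    have "harm n - ln (real n) \<le> (1 :: real)" using n
    proof (induction n rule: dec_induct)
      case (step m)
      then show ?case using decseqD[OF decseq_harm_diff_ln, of "m - 1" m] by simp
    qed (simp add: harm_def)
    then show "(\<Sum>k\<in>{1..n}. 1 / real k) \<le> 1 + ln (real n)" by (simp add: harm_def inverse_eq_divide)
  qed (use C in auto)
  finally show ?thesis .
qed

section \<open>Letting the loss in the exponent tend to 0\<close>

lemma eventually_prob_product_Schur_le:
  fixes \<delta> :: real
  assumes "\<delta> > 0"
  shows "eventually (\<lambda>n. \<forall>p. 0 \<le> p \<and> p \<le> 1 \<and> p \<le> real n powr (- (1 / 9) - \<delta>) \<longrightarrow>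
    measure_pmf.prob (random_subset n p) {A. product_Schur A} \<le> \<delta>) sequentially"
proof -
  \<comment> \<open>As 162 = 2 * 81, the divisor bound costs half of delta and leaves n^(-delta / 2)
    to beat the logarithm.\<close>
  obtain C where C: "C > 0" "\<And>m. m > 0 \<Longrightarrow> card {d. d dvd m} \<le> C * real m powr (\<delta> / 162)"
    using divisor_bound[of "\<delta> / 162"] assms by auto
  have "(\<lambda>n. real n powr (- \<delta> / 2) * (1 + ln (real n))) \<longlonglongrightarrow> 0"
    using assms by real_asymp
  from tendsto_mult_right_zero[OF this, of "C ^ 9"]
  have "(\<lambda>n. C ^ 9 * real n powr (81 * (\<delta> / 162) - \<delta>) * (1 + ln (real n))) \<longlonglongrightarrow> 0"
    by (simp add: mult.assoc)
  then have "eventually (\<lambda>n. C ^ 9 * real n powr (81 * (\<delta> / 162) - \<delta>) * (1 + ln (real n)) < \<delta>) sequentially"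
    using assms by (rule order_tendstoD)
  then show ?thesis using eventually_ge_at_top[of 1]
  proof eventually_elim
    case (elim n)
    show ?case
    proof (intro allI impI)
      fix p assume p: "0 \<le> p \<and> p \<le> 1 \<and> p \<le> real n powr (- (1 / 9) - \<delta>)"
      have "measure_pmf.prob (random_subset n p) {A. product_Schur A} \<le>
          C ^ 9 * real n powr (81 * (\<delta> / 162) - \<delta>) * (1 + ln (real n))"
        by (rule prob_product_Schur_le) (use p assms C elim(2) in simp_all)
      with elim(1) show "measure_pmf.prob (random_subset n p) {A. product_Schur A} \<le> \<delta>" by linarith
    qed
  qed
qed

text \<open>\<open>g n\<close> is the largest index up to \<open>n\<close> whose property has set in
  for good by \<open>n\<close>.\<close>

lemma eventually_diagonal:
  assumes "\<And>m :: nat. eventually (P m) sequentially"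
  obtains g :: "nat \<Rightarrow> nat" where "filterlim g at_top sequentially" "eventually (\<lambda>n. P (g n) n) sequentially"
proof -
  define G where "G n = {m. m \<le> n \<and> (\<forall>n'\<ge>n. P m n')}" for n
  \<comment> \<open>The inserted 0 is a default for empty \<open>G n\<close>; eventually 0 lies in
    \<open>G n\<close> anyway, so that \<open>g n\<close> does too.\<close>
  define g where "g n = Max (insert 0 (G n))" for n
  have fin: "finite (G n)" for n by (rule finite_subset[of _ "{..n}"]) (auto simp: G_def)
  have ev: "eventually (\<lambda>n. m \<in> G n) sequentially" for m
  proof -
    obtain N where "\<And>n. n \<ge> N \<Longrightarrow> P m n" using assms[of m] by (auto simp: eventually_sequentially)
    then show ?thesis
      unfolding eventually_sequentially by (intro exI[of _ "max m N"]) (auto simp: G_def)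
  qed
  show ?thesis
  proof (rule that[of g])
    show "filterlim g at_top sequentially"
      unfolding filterlim_at_top
    proof
      fix m show "eventually (\<lambda>n. m \<le> g n) sequentially"
        using ev[of m] by eventually_elim (use fin in \<open>auto simp: g_def\<close>)
    qed
    show "eventually (\<lambda>n. P (g n) n) sequentially"
      using ev[of 0]
    proof eventually_elim
      case (elim n)
      then have "g n \<in> G n" using Max_in[OF fin, of n] by (auto simp: g_def insert_absorb)
      then show ?case by (simp add: G_def)
    qed
  qed
qed

text \<open>The preceding estimate is uniform in \<open>p\<close>, so the diagonal sequence can be
  fixed before \<open>p\<close>. The number \<open>1 / Suc (g n)\<close> is both the loss in the
  exponent and the bound on the probability.\<close>

lemma exists_exponent_limit_0:
  "\<exists>\<epsilon> :: nat \<Rightarrow> real. \<epsilon> \<longlonglongrightarrow> 0 \<and>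
      (\<forall>p :: nat \<Rightarrow> real.
         (\<forall>n\<ge>1. 0 \<le> p n \<and> p n \<le> 1) \<and>
         (\<forall>n\<ge>1. p n \<le> real n powr (- (1 / 9) - \<epsilon> n)) \<longrightarrow>
         (\<lambda>n. measure_pmf.prob (random_subset n (p n)) {A. product_Schur A}) \<longlonglongrightarrow> 0)"
proof -
  obtain g :: "nat \<Rightarrow> nat" where g: "filterlim g at_top sequentially"
    and ev: "eventually (\<lambda>n. \<forall>p. 0 \<le> p \<and> p \<le> 1 \<and> p \<le> real n powr (- (1 / 9) - 1 / Suc (g n)) \<longrightarrow>
      measure_pmf.prob (random_subset n p) {A. product_Schur A} \<le> 1 / Suc (g n)) sequentially"
    using eventually_diagonal[of "\<lambda>m n. \<forall>p. 0 \<le> p \<and> p \<le> 1 \<and> p \<le> real n powr (- (1 / 9) - 1 / Suc m) \<longrightarrow>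
      measure_pmf.prob (random_subset n p) {A. product_Schur A} \<le> 1 / Suc m"]
      eventually_prob_product_Schur_le by auto
  have lim: "(\<lambda>n. 1 / real (Suc (g n))) \<longlonglongrightarrow> 0"
    using filterlim_compose[OF lim_1_over_n g] LIMSEQ_inverse_real_of_nat[THEN filterlim_compose, OF g]
    by (simp add: inverse_eq_divide)
  show ?thesis
  proof (intro exI conjI allI impI)
    fix p :: "nat \<Rightarrow> real"
    assume p: "(\<forall>n\<ge>1. 0 \<le> p n \<and> p n \<le> 1) \<and> (\<forall>n\<ge>1. p n \<le> real n powr (- (1 / 9) - 1 / Suc (g n)))"
    show "(\<lambda>n. measure_pmf.prob (random_subset n (p n)) {A. product_Schur A}) \<longlonglongrightarrow> 0"
    proof (rule tendsto_sandwich[OF _ _ tendsto_const lim])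
      show "eventually (\<lambda>n. measure_pmf.prob (random_subset n (p n)) {A. product_Schur A} \<le> 1 / Suc (g n)) sequentially"
        using ev eventually_ge_at_top[of 1] by eventually_elim (use p in auto)
    qed simp
  qed (rule lim)
qed

section \<open>Above the threshold\<close>

text \<open>In a colouring of \<open>x\<close>, \<open>y\<close>, \<open>x * y\<close> without a monochromatic triple one element has the other
  colour than the remaining two. The multiples of \<open>w\<close> exclude that this element is \<open>y\<close>, those of
  \<open>z\<close> the other two cases.\<close>

lemma product_Schur_configuration:
  assumes x: "x \<in> A" and y: "y \<in> A" and xy: "x * y \<in> A"
    and z: "z \<in> A" "z * x \<in> A" "z * x\<^sup>2 \<in> A" "z * (x * y) \<in> A" "z * (x\<^sup>2 * y) \<in> A" "z * (x ^ 3 * y) \<in> A"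
    and w: "w \<in> A" "w * x \<in> A" "w * x\<^sup>2 \<in> A" "w * y \<in> A" "w * (x * y) \<in> A" "w * (x\<^sup>2 * y) \<in> A"
  shows "product_Schur A"
proof (rule ccontr)
  assume "\<not> product_Schur A"
  then obtain f :: "nat \<Rightarrow> bool" where
    "\<forall>a\<in>A. \<forall>b\<in>A. \<forall>c\<in>A. \<not> (f a = f b \<and> f b = f c \<and> a * b = c)"
    unfolding product_Schur_def by auto
  then have N: "\<not> (f a = f b \<and> f b = f c)" if "a \<in> A" "b \<in> A" "c \<in> A" "a * b = c" for a b c
    using that by blast
  note p = power2_eq_square power3_eq_cube mult_ac
  have "\<not> (f x = f y \<and> f y = f (x * y))" by (rule N[OF x y xy refl])
  moreover have "\<not> (f z = f x \<and> f x = f (z * x))"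
    by (rule N[OF z(1) x z(2)]) (simp add: p)
  moreover have "\<not> (f (z * x) = f x \<and> f x = f (z * x\<^sup>2))"
    by (rule N[OF z(2) x z(3)]) (simp add: p)
  moreover have "\<not> (f (z * (x * y)) = f x \<and> f x = f (z * (x\<^sup>2 * y)))"
    by (rule N[OF z(4) x z(5)]) (simp add: p)
  moreover have "\<not> (f (z * (x\<^sup>2 * y)) = f x \<and> f x = f (z * (x ^ 3 * y)))"
    by (rule N[OF z(5) x z(6)]) (simp add: p)
  moreover have "\<not> (f (z * x) = f y \<and> f y = f (z * (x * y)))"
    by (rule N[OF z(2) y z(4)]) (simp add: p)
  moreover have "\<not> (f (z * x\<^sup>2) = f y \<and> f y = f (z * (x\<^sup>2 * y)))"
    by (rule N[OF z(3) y z(5)]) (simp add: p)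
  moreover have "\<not> (f z = f (x * y) \<and> f (x * y) = f (z * (x * y)))"
    by (rule N[OF z(1) xy z(4)]) (simp add: p)
  moreover have "\<not> (f (z * x) = f (x * y) \<and> f (x * y) = f (z * (x\<^sup>2 * y)))"
    by (rule N[OF z(2) xy z(5)]) (simp add: p)
  moreover have "\<not> (f (z * x\<^sup>2) = f (x * y) \<and> f (x * y) = f (z * (x ^ 3 * y)))"
    by (rule N[OF z(3) xy z(6)]) (simp add: p)
  moreover have "\<not> (f w = f x \<and> f x = f (w * x))"
    by (rule N[OF w(1) x w(2)]) (simp add: p)
  moreover have "\<not> (f (w * x) = f x \<and> f x = f (w * x\<^sup>2))"
    by (rule N[OF w(2) x w(3)]) (simp add: p)
  moreover have "\<not> (f (w * y) = f x \<and> f x = f (w * (x * y)))"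
    by (rule N[OF w(4) x w(5)]) (simp add: p)
  moreover have "\<not> (f (w * (x * y)) = f x \<and> f x = f (w * (x\<^sup>2 * y)))"
    by (rule N[OF w(5) x w(6)]) (simp add: p)
  moreover have "\<not> (f w = f y \<and> f y = f (w * y))"
    by (rule N[OF w(1) y w(4)]) (simp add: p)
  moreover have "\<not> (f (w * x) = f y \<and> f y = f (w * (x * y)))"
    by (rule N[OF w(2) y w(5)]) (simp add: p)
  moreover have "\<not> (f (w * x\<^sup>2) = f y \<and> f y = f (w * (x\<^sup>2 * y)))"
    by (rule N[OF w(3) y w(6)]) (simp add: p)
  moreover have "\<not> (f w = f (x * y) \<and> f (x * y) = f (w * (x * y)))"
    by (rule N[OF w(1) xy w(5)]) (simp add: p)
  moreover have "\<not> (f (w * x) = f (x * y) \<and> f (x * y) = f (w * (x\<^sup>2 * y)))"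
    by (rule N[OF w(2) xy w(6)]) (simp add: p)
  \<comment> \<open>Each case splits on the colour of \<open>z * x\<close> or \<open>w * x\<close>.
    For instance, let \<open>y\<close> be the odd one. If \<open>w * x\<close> has the colour of
    \<open>x\<close>, then \<open>w * x\<^sup>2\<close> and \<open>w * (x\<^sup>2 * y)\<close> both
    get that of \<open>y\<close>; otherwise \<open>w\<close> and \<open>w * y\<close> do. Either
    pair is forbidden.\<close>
  ultimately show False by argo
qed

text \<open>Two multipliers differ by a factor below 2, distinct members of \<open>M\<close> by at
  least 2, so the copies are pairwise disjoint. Their elements all exceed \<open>L\<close> and thus
  avoid \<open>S\<close>.\<close>

lemma prob_no_scaled_copy_le:
  fixes p :: real
  assumes p: "0 \<le> p" "p \<le> 1" and S: "S \<subseteq> {1..L}" and n: "2 * L * T \<le> n"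
    and M: "M \<subseteq> {1..T}" "T \<ge> 1" "card M \<le> r" and sep: "\<And>a b. a \<in> M \<Longrightarrow> b \<in> M \<Longrightarrow> a < b \<Longrightarrow> 2 * a \<le> b"
  shows "measure_pmf.prob (random_subset n p) {A. S \<subseteq> A \<and> (\<forall>z\<in>{L+1..2*L}. \<not> (\<lambda>m. z * m) ` M \<subseteq> A)}
    \<le> p ^ card S * exp (- (L * p ^ r))"
proof -
  have less: "z * a \<noteq> z' * b" if "z \<in> {L+1..2*L}" "z' \<in> {L+1..2*L}" "a \<in> M" "b \<in> M" "a < b" for z z' a b
  proof -
    have "z * a \<le> L * (2 * a)" using that by simp
    also have "\<dots> \<le> L * b" using sep[OF that(3-5)] by (rule mult_le_mono2)
    also have "\<dots> < z' * b" using that by simp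
    finally show ?thesis by simp
  qed
  have "measure_pmf.prob (random_subset n p) {A. S \<subseteq> A \<and> (\<forall>z\<in>{L+1..2*L}. \<not> (\<lambda>m. z * m) ` M \<subseteq> A)}
    \<le> p ^ card S * exp (- (card {L+1..2*L} * p ^ r))"
  proof (rule prob_superset_avoiding_le)
    have "L * 1 \<le> 2 * L * T" using M(2) by (intro mult_le_mono) auto
    then have "L \<le> n" using n by linarith
    then show "S \<subseteq> {1..n}" by (intro order_trans[OF S]) auto
    fix z assume z: "z \<in> {L+1..2*L}"
    show "(\<lambda>m. z * m) ` M \<subseteq> {1..n}"
    proof
      fix u assume "u \<in> (\<lambda>m. z * m) ` M"
      then obtain m where m: "u = z * m" "m \<in> M" by blast
      have "1 \<le> m" "m \<le> T" using m M(1) by auto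
      have "z * m \<le> 2 * L * T" using z \<open>m \<le> T\<close> by (intro mult_le_mono) auto
      with n z \<open>1 \<le> m\<close> m show "u \<in> {1..n}" by auto
    qed
    have "L < z * m" if "m \<in> M" for m
    proof -
      have "1 \<le> m" using that M(1) by auto
      then have "z \<le> z * m" by simp
      moreover have "L < z" using z by simp
      ultimately show ?thesis by (rule less_le_trans[rotated])
    qed
    then show "S \<inter> (\<lambda>m. z * m) ` M = {}" using S by fastforce
    show "card ((\<lambda>m. z * m) ` M) \<le> r"
      using M finite_subset[OF M(1)] card_image_le[of M "\<lambda>m. z * m"] by simp
  next
    show "disjoint_family_on (\<lambda>z. (\<lambda>m. z * m) ` M) {L+1..2*L}"
    proof (unfold disjoint_family_on_def, intro ballI impI)
      fix z z' assume z: "z \<in> {L+1..2*L}" "z' \<in> {L+1..2*L}" "z \<noteq> z'"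
      have "z * a \<noteq> z' * b" if "a \<in> M" "b \<in> M" for a b
      proof -
        consider "a < b" | "b < a" | "a = b" by linarith
        then show ?thesis
        proof cases
          case 3
          then show ?thesis using z that M(1) by auto
        qed (use less[of z z' a b] less[of z' z b a] z that in auto)
      qed
      then show "(\<lambda>m. z * m) ` M \<inter> (\<lambda>m. z' * m) ` M = {}" by fastforce
    qed
  qed (use p in auto)
  then show ?thesis by simp
qed

lemma doubling_chain:
  fixes a b c d e f T :: nat
  assumes "1 \<le> a" "2 * a \<le> b" "2 * b \<le> c" "2 * c \<le> d" "2 * d \<le> e" "2 * e \<le> f" "f \<le> T"
  shows "{a, b, c, d, e, f} \<subseteq> {1..T} \<and> card {a, b, c, d, e, f} \<le> 6 \<and>
    (\<forall>x\<in>{a, b, c, d, e, f}. \<forall>y\<in>{a, b, c, d, e, f}. x < y \<longrightarrow> 2 * x \<le> y)"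
proof (intro conjI)
  show "card {a, b, c, d, e, f} \<le> 6"
    using card_length[of "[a, b, c, d, e, f]"] by simp
qed (use assms in auto)

text \<open>The ranges are chosen so that every copy looked for is disjoint from the numbers found before.
  With \<open>x\<close>, \<open>y\<close>, \<open>z\<close> of order \<open>l\<close>, \<open>l\<^sup>2\<close>, \<open>l\<^sup>6\<close> the largest number \<open>z * (x ^ 3 * y)\<close> has order
  \<open>l ^ 11\<close>, which is where the exponent 1/11 comes from.\<close>

lemma prob_not_product_Schur_le:
  fixes p :: real and l n :: nat
  assumes p: "0 \<le> p" "p \<le> 1" and l: "l \<ge> 1" and n: "8192 * l ^ 11 \<le> n"
  defines "w \<equiv> l * p"
  shows "measure_pmf.prob (random_subset n p) {A. \<not> product_Schur A}
    \<le> exp (- w) + w * exp (- 8 * w ^ 2) + 16 * w ^ 3 * exp (- 32 * w ^ 6)"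
proof -
  let ?P = "measure_pmf.prob (random_subset n p)"
  \<comment> \<open>As x <= 2 * l, starting at 8 * l^2 makes y > 2 * x^2, which keeps consecutive
    multipliers a factor 2 apart. The start 32 * l^6 is at least x * y.\<close>
  let ?X = "{l+1..2*l}" and ?Y = "{8*l\<^sup>2+1..2*(8*l\<^sup>2)}" and ?Z = "{32*l^6+1..2*(32*l^6)}"
  define M1 where "M1 x y = {1, x, x\<^sup>2, x * y, x\<^sup>2 * y, x ^ 3 * y}" for x y :: nat
  define M2 where "M2 x y = {1, x, x\<^sup>2, y, x * y, x\<^sup>2 * y}" for x y :: nat
  \<comment> \<open>The failures to find \<open>x\<close>, then \<open>y\<close>, then a multiplier
    for \<open>M1\<close> or \<open>M2\<close>, each joint with success at the earlier
    stages.\<close>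
  define B0 where "B0 = {A. {} \<subseteq> A \<and> (\<forall>x\<in>?X. \<not> (\<lambda>m. x * m) ` {1} \<subseteq> A)}"
  define B1 where "B1 x = {A. {x} \<subseteq> A \<and> (\<forall>y\<in>?Y. \<not> (\<lambda>m. y * m) ` {1, x} \<subseteq> A)}" for x
  define B2 where "B2 M x y = {A. {x, y, x * y} \<subseteq> A \<and> (\<forall>z\<in>?Z. \<not> (\<lambda>m. z * m) ` M x y \<subseteq> A)}"
    for M :: "nat \<Rightarrow> nat \<Rightarrow> nat set" and x y
  have pow: "l ^ i \<le> l ^ j" if "i \<le> j" for i j using l that by (intro power_increasing) auto
  have "{A. \<not> product_Schur A} \<subseteq> B0 \<union> (\<Union>x\<in>?X. B1 x) \<union> (\<Union>x\<in>?X. \<Union>y\<in>?Y. B2 M1 x y \<union> B2 M2 x y)"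
  proof (rule subsetI, rule ccontr)
    fix A assume "A \<in> {A. \<not> product_Schur A}"
      and out: "A \<notin> B0 \<union> (\<Union>x\<in>?X. B1 x) \<union> (\<Union>x\<in>?X. \<Union>y\<in>?Y. B2 M1 x y \<union> B2 M2 x y)"
    then have nS: "\<not> product_Schur A" by simp
    have out0: "A \<notin> B0" and out1: "x \<in> ?X \<Longrightarrow> A \<notin> B1 x"
      and out2: "x \<in> ?X \<Longrightarrow> y \<in> ?Y \<Longrightarrow> A \<notin> B2 M1 x y \<and> A \<notin> B2 M2 x y" for x y
      using out by blast+
    obtain x where x: "x \<in> ?X" "x \<in> A" using out0 unfolding B0_def by auto
    then obtain y where y: "y \<in> ?Y" "(\<lambda>m. y * m) ` {1, x} \<subseteq> A"
      using out1[OF x(1)] unfolding B1_def by blast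
    then have xy: "y \<in> A" "x * y \<in> A" by (simp_all add: mult.commute)
    then obtain z u where zu: "(\<lambda>m. z * m) ` M1 x y \<subseteq> A" "(\<lambda>m. u * m) ` M2 x y \<subseteq> A"
      using out2[OF x(1) y(1)] x unfolding B2_def by blast
    have "product_Schur A"
      by (rule product_Schur_configuration[of x A y z u]) (use x xy zu in \<open>simp_all add: M1_def M2_def\<close>)
    with nS show False by blast
  qed
  then have "?P {A. \<not> product_Schur A} \<le>
      ?P (B0 \<union> (\<Union>x\<in>?X. B1 x) \<union> (\<Union>x\<in>?X. \<Union>y\<in>?Y. B2 M1 x y \<union> B2 M2 x y))"
    by (intro measure_pmf.finite_measure_mono) auto
  also have "\<dots> \<le> ?P (B0 \<union> (\<Union>x\<in>?X. B1 x)) + ?P (\<Union>x\<in>?X. \<Union>y\<in>?Y. B2 M1 x y \<union> B2 M2 x y)"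
    by (rule measure_Un_le) auto
  also have "?P (B0 \<union> (\<Union>x\<in>?X. B1 x)) \<le> ?P B0 + ?P (\<Union>x\<in>?X. B1 x)"
    by (rule measure_Un_le) auto
  also have "?P (\<Union>x\<in>?X. B1 x) \<le> (\<Sum>x\<in>?X. ?P (B1 x))"
    by (rule measure_pmf.finite_measure_subadditive_finite) auto
  also have "?P (\<Union>x\<in>?X. \<Union>y\<in>?Y. B2 M1 x y \<union> B2 M2 x y) \<le> (\<Sum>x\<in>?X. ?P (\<Union>y\<in>?Y. B2 M1 x y \<union> B2 M2 x y))"
    by (rule measure_pmf.finite_measure_subadditive_finite) auto
  also have "\<dots> \<le> (\<Sum>x\<in>?X. \<Sum>y\<in>?Y. ?P (B2 M1 x y \<union> B2 M2 x y))"
    by (intro sum_mono measure_pmf.finite_measure_subadditive_finite) auto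
  also have "\<dots> \<le> (\<Sum>x\<in>?X. \<Sum>y\<in>?Y. ?P (B2 M1 x y) + ?P (B2 M2 x y))"
    by (intro sum_mono measure_Un_le) auto
  also have "?P B0 \<le> exp (- w)"
  proof -
    have "2 * l * 1 \<le> n" using n pow[of 1 11] by simp
    then have "?P B0 \<le> p ^ card ({} :: nat set) * exp (- (l * p ^ 1))"
      unfolding B0_def using p by (intro prob_no_scaled_copy_le) auto
    then show ?thesis by (simp add: w_def)
  qed
  also have "(\<Sum>x\<in>?X. ?P (B1 x)) \<le> w * exp (- 8 * w ^ 2)"
  proof -
    have "?P (B1 x) \<le> p ^ 1 * exp (- ((8 * l\<^sup>2) * p ^ 2))" if x: "x \<in> ?X" for x
    proof -
      have "2 * (8 * l\<^sup>2) * (2 * l) \<le> n" using n pow[of 3 11] by (simp add: power2_eq_square power3_eq_cube)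
      moreover have "2 * l \<le> 8 * l\<^sup>2" using l by (simp add: power2_eq_square)
      ultimately have "?P (B1 x) \<le> p ^ card {x} * exp (- (real (8 * l\<^sup>2) * p ^ 2))"
        unfolding B1_def using p x l by (intro prob_no_scaled_copy_le[where T = "2 * l"]) auto
      then show ?thesis by simp
    qed
    then have "(\<Sum>x\<in>?X. ?P (B1 x)) \<le> (\<Sum>x\<in>?X. p ^ 1 * exp (- ((8 * l\<^sup>2) * p ^ 2)))" by (intro sum_mono)
    then show ?thesis by (simp add: w_def power_mult_distrib algebra_simps)
  qed
  also have "(\<Sum>x\<in>?X. \<Sum>y\<in>?Y. ?P (B2 M1 x y) + ?P (B2 M2 x y)) \<le> 16 * w ^ 3 * exp (- 32 * w ^ 6)"
  proof -
    have B2: "?P (B2 M x y) \<le> p ^ 3 * exp (- ((32 * l ^ 6) * p ^ 6))"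
      if xy: "x \<in> ?X" "y \<in> ?Y" and M: "M x y \<in> {M1 x y, M2 x y}" for M x y
    proof -
      have x: "2 \<le> x" "x \<le> 2 * l" using xy l by auto
      have y: "y \<le> 16 * l\<^sup>2" using xy by auto
      have "x\<^sup>2 \<le> (2 * l)\<^sup>2" using x by (intro power_mono) auto
      then have xy2: "2 * x\<^sup>2 \<le> y" using xy by (simp add: power_mult_distrib)
      have chain: "2 * 1 \<le> x" "2 * x \<le> x\<^sup>2" "2 * x\<^sup>2 \<le> y"
        "2 * y \<le> x * y" "2 * (x * y) \<le> x\<^sup>2 * y" "2 * (x\<^sup>2 * y) \<le> x ^ 3 * y"
        using x xy2 by (auto simp: power2_eq_square power3_eq_cube)
      then have x2y: "2 * x\<^sup>2 \<le> x * y" by linarith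
      have "x ^ 3 * y \<le> (2 * l) ^ 3 * (16 * l\<^sup>2)" using x y by (intro mult_le_mono power_mono) auto
      also have "\<dots> = 128 * l ^ 5" by (simp add: power_mult_distrib flip: power_add)
      finally have top: "x ^ 3 * y \<le> 128 * l ^ 5" .
      have "x * y \<le> 2 * l * (16 * l\<^sup>2)" using x y by (intro mult_le_mono) auto
      also have "\<dots> = 32 * l ^ 3" by (simp add: power2_eq_square power3_eq_cube)
      also have "\<dots> \<le> 32 * l ^ 6" using pow[of 3 6] by simp
      finally have xyl: "x * y \<le> 32 * l ^ 6" .
      define Q where "Q N \<longleftrightarrow> N \<subseteq> {1..128 * l ^ 5} \<and> card N \<le> 6 \<and>
        (\<forall>a\<in>N. \<forall>b\<in>N. a < b \<longrightarrow> 2 * a \<le> b)" for N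
      have "Q (M1 x y)"
        unfolding M1_def Q_def by (rule doubling_chain[OF order.refl chain(1,2) x2y chain(5,6) top])
      moreover have "Q (M2 x y)"
        unfolding M2_def Q_def by (rule doubling_chain[OF order.refl chain(1-5)]) (use chain(6) top in linarith)
      ultimately have "Q (M x y)" using M by auto
      then have Mxy: "M x y \<subseteq> {1..128 * l ^ 5}" "card (M x y) \<le> 6"
        and sep: "\<And>a b. a \<in> M x y \<Longrightarrow> b \<in> M x y \<Longrightarrow> a < b \<Longrightarrow> 2 * a \<le> b"
        by (simp_all add: Q_def)
      have S: "{x, y, x * y} \<subseteq> {1..32 * l ^ 6}"
      proof -
        have "1 \<le> x" "x \<le> y" "y \<le> x * y" using chain by linarith+
        with xyl have "x \<le> 32 * l ^ 6" "y \<le> 32 * l ^ 6" "1 \<le> y" "1 \<le> x * y" by linarith+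
        with \<open>1 \<le> x\<close> xyl show ?thesis by simp
      qed
      have "?P (B2 M x y) \<le> p ^ card {x, y, x * y} * exp (- (real (32 * l ^ 6) * p ^ 6))"
        unfolding B2_def
      proof (rule prob_no_scaled_copy_le[where T = "128 * l ^ 5"])
        \<comment> \<open>The source of 8192 = 2 * 32 * 128 and of 11 = 6 + 5.\<close>
        show "2 * (32 * l ^ 6) * (128 * l ^ 5) \<le> n" using n by (simp flip: power_add)
      qed (use p l S Mxy sep in \<open>simp_all add: Suc_le_eq\<close>)
      moreover have "card {x, y, x * y} = 3"
      proof -
        have "x < y" "y < x * y" using chain x by linarith+
        then show ?thesis by simp
      qed
      ultimately show ?thesis by simp
    qed
    \<comment> \<open>There are l * 8 * l^2 pairs and two patterns, whence 16 * w^3.\<close>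
    have "(\<Sum>x\<in>?X. \<Sum>y\<in>?Y. ?P (B2 M1 x y) + ?P (B2 M2 x y)) \<le>
        (\<Sum>x\<in>?X. \<Sum>y\<in>?Y. p ^ 3 * exp (- ((32 * l ^ 6) * p ^ 6)) + p ^ 3 * exp (- ((32 * l ^ 6) * p ^ 6)))"
      by (intro sum_mono add_mono B2) auto
    then show ?thesis by (simp add: w_def power_mult_distrib power2_eq_square power3_eq_cube algebra_simps)
  qed
  finally show ?thesis by simp
qed

lemma limit_1:
  fixes p :: "nat \<Rightarrow> real"
  assumes p: "\<forall>n\<ge>1. 0 \<le> p n \<and> p n \<le> 1"
    and lim: "filterlim (\<lambda>n. p n * real n powr (1 / 11)) at_top sequentially"
  shows "(\<lambda>n. measure_pmf.prob (random_subset n (p n)) {A. product_Schur A}) \<longlonglongrightarrow> 1"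
proof -
  \<comment> \<open>Dividing by 4 ensures 8192 * l^11 <= n, as 4^11 = 2^22. Once n^(1/11) >= 8,
    rounding down still leaves l >= n^(1/11) / 8, so \<open>w\<close> tends to infinity.\<close>
  define l where "l n = nat \<lfloor>real n powr (1 / 11) / 4\<rfloor>" for n
  define w where "w n = l n * p n" for n
  let ?g = "\<lambda>w :: real. exp (- w) + w * exp (- 8 * w ^ 2) + 16 * w ^ 3 * exp (- 32 * w ^ 6)"
  have large: "eventually (\<lambda>n. real n powr (1 / 11) \<ge> 8) sequentially" by real_asymp
  have "filterlim (\<lambda>n. (1 / 8) * (p n * real n powr (1 / 11))) at_top sequentially"
    by (rule filterlim_tendsto_pos_mult_at_top[OF tendsto_const _ lim]) simp
  then have "filterlim w at_top sequentially"
  proof (rule filterlim_at_top_mono)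
    show "eventually (\<lambda>n. (1 / 8) * (p n * real n powr (1 / 11)) \<le> w n) sequentially"
      using large eventually_ge_at_top[of 1]
    proof eventually_elim
      case (elim n)
      then have "real n powr (1 / 11) / 8 \<le> l n" unfolding l_def by linarith
      then have "real n powr (1 / 11) / 8 * p n \<le> l n * p n" using p elim by (intro mult_right_mono) auto
      then show ?case by (simp add: w_def mult.commute)
    qed
  qed
  moreover have "(?g \<longlongrightarrow> 0) at_top" by real_asymp
  ultimately have "(\<lambda>n. ?g (w n)) \<longlonglongrightarrow> 0" by (rule filterlim_compose[rotated])
  then have lim_g: "(\<lambda>n. 1 - ?g (w n)) \<longlonglongrightarrow> 1" using tendsto_diff[OF tendsto_const] by fastforce
  show ?thesis
  proof (rule tendsto_sandwich[OF _ _ lim_g tendsto_const])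
    show "eventually (\<lambda>n. 1 - ?g (w n) \<le> measure_pmf.prob (random_subset n (p n)) {A. product_Schur A}) sequentially"
      using large eventually_ge_at_top[of 1]
    proof eventually_elim
      case (elim n)
      have l1: "l n \<ge> 1" "real (l n) \<le> real n powr (1 / 11) / 4" using elim unfolding l_def by linarith+
      have "real (l n) ^ 11 \<le> (real n powr (1 / 11) / 4) ^ 11" using l1 by (intro power_mono) auto
      also have "\<dots> = real n / 4 ^ 11" using elim by (simp add: power_divide powr_power)
      finally have "8192 * l n ^ 11 \<le> n" by (simp add: field_simps flip: of_nat_le_iff[where ?'a = real])
      then have "measure_pmf.prob (random_subset n (p n)) {A. \<not> product_Schur A} \<le> ?g (w n)"
        unfolding w_def using prob_not_product_Schur_le[of "p n" "l n" n] p elim l1 by simp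
      moreover have "measure_pmf.prob (random_subset n (p n)) {A. \<not> product_Schur A} =
          1 - measure_pmf.prob (random_subset n (p n)) {A. product_Schur A}"
        using measure_pmf.prob_compl[of "{A. product_Schur A}" "random_subset n (p n)"]
        by (simp add: set_diff_eq)
      ultimately show ?case by linarith
    qed
  qed simp
qed

theorem theorem1p2:
  "(\<exists>\<epsilon> :: nat \<Rightarrow> real. \<epsilon> \<longlonglongrightarrow> 0 \<and>
      (\<forall>p :: nat \<Rightarrow> real.
         (\<forall>n\<ge>1. 0 \<le> p n \<and> p n \<le> 1) \<and>
         (\<forall>n\<ge>1. p n \<le> real n powr (- (1 / 9) - \<epsilon> n)) \<longrightarrow>
         (\<lambda>n. measure_pmf.prob (random_subset n (p n)) {A. product_Schur A}) \<longlonglongrightarrow> 0)) \<and>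
   (\<forall>p :: nat \<Rightarrow> real.
      (\<forall>n\<ge>1. 0 \<le> p n \<and> p n \<le> 1) \<and>
      filterlim (\<lambda>n. p n * real n powr (1 / 11)) at_top sequentially \<longrightarrow>
      (\<lambda>n. measure_pmf.prob (random_subset n (p n)) {A. product_Schur A}) \<longlonglongrightarrow> 1)"
  using exists_exponent_limit_0 limit_1 by blast

end
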